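(* Fix an integer $t\geq 1$. For every integer $n\geq 1$, the number $p(n,t)$ of partitions of $n$ whose largest part minus smallest part is at most $t$ equals the number of pairs $(\lambda,\ell)$ where $\ell\in\mathbb{Z}_{\geq 0}$ is divisible by $t$ and $\lambda$ is a non-empty partition of $n-\ell$ with largest part at most $t$. Moreover, there is an explicit bijection between these two sets.
   Context: A partition of $n$ is a weakly decreasing finite sequence of positive integers summing to $n$; partitions counted by $p(n,t)$ are non-empty. *)

theory Defs
  imports Main
begin

definition is_partition :: "nat \<Rightarrow> nat list \<Rightarrow> bool" where
  "is_partition n xs \<longleftrightarrow>
     sorted_wrt (\<ge>) xs \<and> (\<forall>x\<in>set xs. 0 < x) \<and> sum_list xs = n"

definition largest_part :: "nat list \<Rightarrow> nat" where
  "largest_part xs = Max (set xs)"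

definition smallest_part :: "nat list \<Rightarrow> nat" where
  "smallest_part xs = Min (set xs)"

definition bounded_diff_partitions :: "nat \<Rightarrow> nat \<Rightarrow> nat list set" where
  "bounded_diff_partitions n t =
     {xs. is_partition n xs \<and> xs \<noteq> [] \<and> largest_part xs - smallest_part xs \<le> t}"

definition p :: "nat \<Rightarrow> nat \<Rightarrow> nat" where
  "p n t = card (bounded_diff_partitions n t)"

text \<open>The condition \<open>l \<le> n\<close> keeps the natural-number subtraction \<open>n - l\<close> from truncating;
  a negative integer has no partitions.\<close>

definition partition_multiple_pairs :: "nat \<Rightarrow> nat \<Rightarrow> (nat list \<times> nat) set" where
  "partition_multiple_pairs n t =
     {(xs, l). t dvd l \<and> l \<le> n \<and> is_partition (n - l) xs \<and> xs \<noteq> [] \<and> largest_part xs \<le> t}"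

text \<open>Add \<open>t\<close> to a smallest part. If the largest and smallest parts of the weakly decreasing
  list differ by at most \<open>t\<close>, the increased part is a largest one and so belongs at the front.\<close>

definition raise_smallest :: "nat \<Rightarrow> nat list \<Rightarrow> nat list" where
  "raise_smallest t xs = (last xs + t) # butlast xs"

text \<open>The explicit bijection: distribute \<open>l\<close> over the parts in portions of size \<open>t\<close>, each time
  to a currently smallest part. The inverse repeatedly subtracts \<open>t\<close> from a largest part until
  all parts are at most \<open>t\<close>.\<close>

definition distribute :: "nat \<Rightarrow> nat list \<times> nat \<Rightarrow> nat list" where
  "distribute t = (\<lambda>(xs, l). (raise_smallest t ^^ (l div t)) xs)"

lemma length_le_sum_list:
  assumes "\<forall>x\<in>set xs. 0 < (x::nat)"
  shows "length xs \<le> sum_list xs"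
  using assms by (induction xs) auto

lemma finite_partitions: "finite {xs. is_partition n xs}"
proof (rule finite_subset)
  show "{xs. is_partition n xs} \<subseteq> {xs. set xs \<subseteq> {..n} \<and> length xs \<le> n}"
    using length_le_sum_list member_le_sum_list by (fastforce simp: is_partition_def)
  show "finite {xs. set xs \<subseteq> {..n} \<and> length xs \<le> n}"
    by (rule finite_lists_length_le) simp
qed

lemma finite_bounded_diff_partitions: "finite (bounded_diff_partitions n t)"
  by (rule finite_subset[OF _ finite_partitions[of n]]) (auto simp: bounded_diff_partitions_def)

lemma finite_partition_multiple_pairs: "finite (partition_multiple_pairs n t)"
proof (rule finite_subset)
  show "partition_multiple_pairs n t \<subseteq> (\<Union>m\<le>n. {xs. is_partition m xs}) \<times> {..n}"
    unfolding partition_multiple_pairs_def by (auto intro!: bexI[of _ "n - _"])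
  show "finite ((\<Union>m\<le>n. {xs. is_partition m xs}) \<times> {..n})"
    by (simp add: finite_partitions)
qed

end

theory Submission
  imports Defs
begin

text \<open>Raising the smallest part by \<open>t\<close> is inverted, on partitions whose parts differ by at most
  \<open>t\<close>, by lowering the largest part by \<open>t\<close>; the image of raising consists exactly of those
  partitions whose largest part exceeds \<open>t\<close>. Hence every partition in question is obtained in a
  unique way from one with largest part at most \<open>t\<close> by a number \<open>k\<close> of raisings, and this pairs
  it with \<open>l = k * t\<close>.\<close>

lemma sorted_wrt_ge_last_le:
  fixes xs :: "'a::preorder list"
  assumes "sorted_wrt (\<ge>) xs" and "x \<in> set xs"
  shows "last xs \<le> x"
  using assms by (induction xs) auto

lemma sorted_wrt_ge_le_hd:
  fixes xs :: "'a::preorder list"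
  assumes "sorted_wrt (\<ge>) xs" and "x \<in> set xs"
  shows "x \<le> hd xs"
  using assms by (cases xs) auto

lemma largest_part_eq_hd:
  assumes "sorted_wrt (\<ge>) xs" and "xs \<noteq> []"
  shows "largest_part xs = hd xs"
  unfolding largest_part_def using assms by (intro Max_eqI) (auto intro: sorted_wrt_ge_le_hd)

lemma smallest_part_eq_last:
  assumes "sorted_wrt (\<ge>) xs" and "xs \<noteq> []"
  shows "smallest_part xs = last xs"
  unfolding smallest_part_def using assms by (intro Min_eqI) (auto intro: sorted_wrt_ge_last_le)

text \<open>Both sides of the bijection are described by this one predicate. In a weakly decreasing
  list the extreme parts are \<open>hd\<close> and \<open>last\<close>, and the additive bound
  avoids truncated subtraction.\<close>

definition narrow :: "nat \<Rightarrow> nat list \<Rightarrow> bool" where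
  "narrow t xs \<longleftrightarrow> xs \<noteq> [] \<and> sorted_wrt (\<ge>) xs \<and> 0 < last xs \<and> hd xs \<le> last xs + t"

lemma positive_parts_iff_last:
  assumes "sorted_wrt (\<ge>) xs" and "xs \<noteq> []"
  shows "(\<forall>x\<in>set xs. 0 < (x::nat)) \<longleftrightarrow> 0 < last xs"
  using assms sorted_wrt_ge_last_le last_in_set by (metis less_le_trans)

lemma mem_bounded_diff_partitions_iff:
  "xs \<in> bounded_diff_partitions n t \<longleftrightarrow> narrow t xs \<and> sum_list xs = n"
  unfolding bounded_diff_partitions_def is_partition_def narrow_def
  using positive_parts_iff_last[of xs] largest_part_eq_hd[of xs] smallest_part_eq_last[of xs]
  by (cases "xs \<noteq> [] \<and> sorted_wrt (\<ge>) xs") (simp, linarith, blast)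

text \<open>\<open>narrow\<close> costs nothing here: \<open>hd xs \<le> t\<close> already bounds
  the difference of the extreme parts.\<close>

lemma mem_partition_multiple_pairs_iff:
  "(xs, l) \<in> partition_multiple_pairs n t \<longleftrightarrow>
     t dvd l \<and> narrow t xs \<and> hd xs \<le> t \<and> sum_list xs + l = n"
  unfolding partition_multiple_pairs_def is_partition_def narrow_def
  using positive_parts_iff_last[of xs] largest_part_eq_hd[of xs]
  by (cases "xs \<noteq> [] \<and> sorted_wrt (\<ge>) xs") (simp, linarith, blast)

lemma sum_list_raise_smallest:
  assumes "xs \<noteq> []"
  shows "sum_list (raise_smallest t xs) = sum_list xs + t"
  using assms by (cases xs rule: rev_cases) (auto simp: raise_smallest_def)

text \<open>The old bound says exactly that the new head dominates the other parts. The new last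
  part is at least the old one, so the new difference is again at most \<open>t\<close>.\<close>

lemma narrow_raise_smallest:
  assumes "narrow t xs"
  shows "narrow t (raise_smallest t xs)"
proof -
  obtain ys y where xs: "xs = ys @ [y]"
    using assms by (metis narrow_def rev_exhaust)
  have "z \<le> y + t" if "z \<in> set ys" for z
    using assms that sorted_wrt_ge_le_hd[of xs z] by (auto simp: narrow_def xs)
  moreover have "0 < last ys" if "ys \<noteq> []"
    using assms that sorted_wrt_ge_last_le[of xs "last ys"] by (auto simp: narrow_def xs)
  ultimately show ?thesis
    using assms by (auto simp: narrow_def raise_smallest_def xs sorted_wrt_append)
qed

text \<open>Since parts are positive, this separates partitions with all parts at most
  \<open>t\<close> from the results of a raising.\<close>

lemma hd_raise_smallest_gt:
  assumes "narrow t xs"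
  shows "t < hd (raise_smallest t xs)"
  using assms by (simp add: narrow_def raise_smallest_def)

lemma raise_smallest_inject:
  assumes "raise_smallest t xs = raise_smallest t ys" and "xs \<noteq> []" and "ys \<noteq> []"
  shows "xs = ys"
  using assms by (metis add_right_cancel append_butlast_last_id list.inject raise_smallest_def)

text \<open>The preimage moves the head \<open>z\<close> to the end as \<open>z - t\<close>; this is
  positive because \<open>t < z\<close>.\<close>

lemma raise_smallest_surj:
  assumes "narrow t xs" and "t < hd xs"
  obtains ys where "narrow t ys" and "raise_smallest t ys = xs"
proof -
  obtain z zs where xs: "xs = z # zs"
    using assms by (cases xs) (auto simp: narrow_def)
  \<comment> \<open>By narrowness \<open>z\<close> is at most \<open>last xs + t\<close>, hence at
    most \<open>w + t\<close>.\<close>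
  have "z - t \<le> w" if "w \<in> set zs" for w
    using assms that sorted_wrt_ge_last_le[of xs w] by (auto simp: narrow_def xs)
  then have "narrow t (zs @ [z - t])"
    using assms by (auto simp: narrow_def xs sorted_wrt_append hd_append)
  moreover have "raise_smallest t (zs @ [z - t]) = xs"
    using assms by (simp add: raise_smallest_def xs)
  ultimately show thesis
    using that by blast
qed

lemma narrow_funpow_raise_smallest:
  assumes "narrow t xs"
  shows "narrow t ((raise_smallest t ^^ k) xs)"
  using assms by (induction k) (simp_all add: narrow_raise_smallest)

lemma sum_list_funpow_raise_smallest:
  assumes "narrow t xs"
  shows "sum_list ((raise_smallest t ^^ k) xs) = sum_list xs + k * t"
proof (induction k)
  case (Suc k)
  have "(raise_smallest t ^^ k) xs \<noteq> []"
    using narrow_funpow_raise_smallest[OF assms, of k] by (simp add: narrow_def)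
  with Suc show ?case
    by (simp add: sum_list_raise_smallest)
qed simp

text \<open>Raisings are cancelled in pairs. Neither side can run out first, since a list with head
  at most \<open>t\<close> is not a raising of a narrow list.\<close>

lemma funpow_raise_smallest_inject:
  assumes "(raise_smallest t ^^ j) xs = (raise_smallest t ^^ k) ys"
    and "narrow t xs" and "hd xs \<le> t" and "narrow t ys" and "hd ys \<le> t"
  shows "j = k \<and> xs = ys"
  using assms(1)
proof (induction j arbitrary: k)
  case 0
  have "k = 0"
  proof (cases k)
    case (Suc i)
    then have "t < hd xs"
      using 0 hd_raise_smallest_gt[OF narrow_funpow_raise_smallest[OF assms(4)]] by simp
    then show ?thesis
      using assms(3) by simp
  qed
  then show ?case
    using 0 by simp
next
  case (Suc j)
  have "t < hd ((raise_smallest t ^^ k) ys)"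
    unfolding Suc.prems[symmetric]
    using hd_raise_smallest_gt[OF narrow_funpow_raise_smallest[OF assms(2)]] by simp
  then obtain i where k: "k = Suc i"
    using assms(5) by (cases k) auto
  have "(raise_smallest t ^^ j) xs = (raise_smallest t ^^ i) ys"
  proof (rule raise_smallest_inject)
    show "raise_smallest t ((raise_smallest t ^^ j) xs) = raise_smallest t ((raise_smallest t ^^ i) ys)"
      using Suc.prems k by simp
    show "(raise_smallest t ^^ j) xs \<noteq> []" "(raise_smallest t ^^ i) ys \<noteq> []"
      using narrow_funpow_raise_smallest[OF assms(2)] narrow_funpow_raise_smallest[OF assms(4)]
      unfolding narrow_def by blast+
  qed
  then show ?case
    using Suc.IH k by simp
qed

text \<open>Undoing raisings while the head exceeds \<open>t\<close> must stop, because each one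
  lowers the sum by \<open>t \<ge> 1\<close>.\<close>

lemma funpow_raise_smallest_surj:
  assumes "t \<ge> 1" and "narrow t ys"
  shows "\<exists>xs k. narrow t xs \<and> hd xs \<le> t \<and> ys = (raise_smallest t ^^ k) xs"
  using assms(2)
proof (induction "sum_list ys" arbitrary: ys rule: less_induct)
  case less
  show ?case
  proof (cases "hd ys \<le> t")
    case True
    with less.prems show ?thesis
      by (intro exI[of _ ys] exI[of _ 0]) simp
  next
    case False
    then obtain zs where zs: "narrow t zs" "raise_smallest t zs = ys"
      using less.prems raise_smallest_surj by (metis not_le)
    have "sum_list zs < sum_list ys"
      using zs \<open>t \<ge> 1\<close> sum_list_raise_smallest[of zs t] by (auto simp: narrow_def)
    then obtain xs k where "narrow t xs" "hd xs \<le> t" "zs = (raise_smallest t ^^ k) xs"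
      using less.hyps zs by blast
    then show ?thesis
      using zs by (intro exI[of _ xs] exI[of _ "Suc k"]) simp
  qed
qed

lemma bij_betw_distribute:
  assumes "t \<ge> 1"
  shows "bij_betw (distribute t) (partition_multiple_pairs n t) (bounded_diff_partitions n t)"
  unfolding bij_betw_def
proof (intro conjI subset_antisym)
  show "inj_on (distribute t) (partition_multiple_pairs n t)"
  proof (rule inj_onI, clarify)
    fix xs l ys m
    assume A: "(xs, l) \<in> partition_multiple_pairs n t" "(ys, m) \<in> partition_multiple_pairs n t"
      "distribute t (xs, l) = distribute t (ys, m)"
    then have "l div t = m div t \<and> xs = ys"
      by (intro funpow_raise_smallest_inject)
        (auto simp: mem_partition_multiple_pairs_iff distribute_def)
    \<comment> \<open>Both \<open>l\<close> and \<open>m\<close> complete the same sum to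
      \<open>n\<close>.\<close>
    with A show "xs = ys \<and> l = m"
      by (auto simp: mem_partition_multiple_pairs_iff)
  qed
  show "distribute t ` partition_multiple_pairs n t \<subseteq> bounded_diff_partitions n t"
    \<comment> \<open>As \<open>t\<close> divides \<open>l\<close>, the \<open>l div t\<close>
      raisings add exactly \<open>l\<close> to the sum.\<close>
    by (auto simp: mem_partition_multiple_pairs_iff mem_bounded_diff_partitions_iff distribute_def
        narrow_funpow_raise_smallest sum_list_funpow_raise_smallest)
  show "bounded_diff_partitions n t \<subseteq> distribute t ` partition_multiple_pairs n t"
  proof
    fix ys
    assume ys: "ys \<in> bounded_diff_partitions n t"
    then obtain xs k where xs: "narrow t xs" "hd xs \<le> t" "ys = (raise_smallest t ^^ k) xs"
      using funpow_raise_smallest_surj[OF assms, of ys]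
      by (auto simp: mem_bounded_diff_partitions_iff)
    then have "(xs, k * t) \<in> partition_multiple_pairs n t"
      using ys by (auto simp: mem_partition_multiple_pairs_iff mem_bounded_diff_partitions_iff
          sum_list_funpow_raise_smallest)
    \<comment> \<open>Here \<open>t \<ge> 1\<close> gives \<open>k * t div t = k\<close>.\<close>
    moreover have "ys = distribute t (xs, k * t)"
      using xs assms by (simp add: distribute_def)
    ultimately show "ys \<in> distribute t ` partition_multiple_pairs n t"
      by blast
  qed
qed

theorem theorem3:
  fixes t n :: nat
  assumes "t \<ge> 1" and "n \<ge> 1"
  shows "p n t = card (partition_multiple_pairs n t)
       \<and> bij_betw (distribute t) (partition_multiple_pairs n t) (bounded_diff_partitions n t)"
  using bij_betw_distribute[OF assms(1)] bij_betw_same_card[OF bij_betw_distribute[OF assms(1)]]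
  by (simp add: p_def)

end
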